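(* Let $a>1$ and $b\in\mathbb{C}$ be such that $C_{az+b}$ is a bounded composition operator on $\mathcal{H}(\beta,\Lambda)$, and suppose that $(\lambda_n)_{n\ge1}$ has at least two non-zero initial points with respect to $a$. Then $C_{az+b}$ is not cyclic.
   Context: $\mathbb{N}=\{1,2,\dots\}$. $\Lambda=(\lambda_n)_{n\ge1}$ is a strictly increasing sequence of non-negative real numbers tending to $\infty$ with $L:=\limsup_{n\to\infty}\frac{\log n}{\lambda_n}<\infty$. $\beta=(\beta_n)_{n\ge1}$ is a sequence of positive real numbers with $\beta_*:=\liminf_{n\to\infty}\frac{\log\beta_n}{\lambda_n}\neq\pm\infty$. For $r\in\mathbb{R}$, $\mathbb{C}_r=\{z\in\mathbb{C}:\operatorname{Re}(z)>r\}$. $\mathcal{H}(\beta,\Lambda)$ is the space of Dirichlet series $f(z)=\sum_{n=1}^\infty a_ne^{-\lambda_nz}$ with $\sum_{n=1}^\infty|a_n|^2\beta_n^2<\infty$; such series converge to holomorphic functions on $\mathbb{C}_{L/2-\beta_*}$, their coefficients are uniquely determined by $f$, and $\mathcal{H}(\beta,\Lambda)$ is a Hilbert space with inner product $\langle f,g\rangle=\sum_{n}a_n\overline{b_n}\beta_n^2$. $C_\varphi f=f\circ\varphi$ ($C_{az+b}$ is $C_\varphi$ for $\varphi(z)=az+b$); "$C_\varphi$ is a bounded composition operator on $\mathcal{H}(\beta,\Lambda)$" means that $\varphi$ is a holomorphic self-map of $\mathbb{C}_{L/2-\beta_*}$ and $C_\varphi$ maps $\mathcal{H}(\beta,\Lambda)$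 into itself boundedly. If $C_{az+b}$ is bounded with $a>1$, then for every $n$ there is $m\ge n$ with $a\lambda_n=\lambda_m$. A term $\lambda_k$ is an initial point with respect to $a$ if there is no $n<k$ such that $a^s\lambda_n=\lambda_k$ for some $s\in\mathbb{N}$. A bounded operator $T$ on a Hilbert space $\mathcal{H}$ is cyclic if there is $x\in\mathcal{H}$ such that the linear span of $\operatorname{Orb}(T,x)=\{T^nx:n=0,1,2,\dots\}$ is dense in $\mathcal{H}$. *)

theory Defs
  imports "HOL-Analysis.Analysis" "HOL-Library.Function_Algebras"
begin

text \<open>
  Sequences are indexed from 0: the \<open>n\<close>-th entry of a sequence here is the entry with index
  \<open>n + 1\<close> in the mathematical notation, where indices start at 1. This is why \<open>Suc n\<close> appears
  in the definition of \<open>L\<close>.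
\<close>

definition dir_L :: "(nat \<Rightarrow> real) \<Rightarrow> ereal" where
  "dir_L lam = limsup (\<lambda>n. ereal (ln (real (Suc n)) / lam n))"

definition dir_beta_star :: "(nat \<Rightarrow> real) \<Rightarrow> (nat \<Rightarrow> real) \<Rightarrow> ereal" where
  "dir_beta_star beta lam = liminf (\<lambda>n. ereal (ln (beta n) / lam n))"

definition half_plane :: "real \<Rightarrow> complex set" where
  "half_plane r = {z. Re z > r}"

definition dir_domain :: "(nat \<Rightarrow> real) \<Rightarrow> (nat \<Rightarrow> real) \<Rightarrow> complex set" where
  "dir_domain beta lam =
     half_plane (real_of_ereal (dir_L lam) / 2 - real_of_ereal (dir_beta_star beta lam))"

text \<open>
  A function on the half-plane is encoded as a function on all of \<open>complex\<close> that vanishes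
  outside the half-plane, so that functions are equal iff they agree on the half-plane and the
  space is a linear subspace of \<open>complex \<Rightarrow> complex\<close>.
\<close>

definition dir_coeffs_of ::
    "(nat \<Rightarrow> real) \<Rightarrow> (nat \<Rightarrow> real) \<Rightarrow> (complex \<Rightarrow> complex) \<Rightarrow> (nat \<Rightarrow> complex) \<Rightarrow> bool" where
  "dir_coeffs_of beta lam f a \<longleftrightarrow>
     summable (\<lambda>n. (cmod (a n))\<^sup>2 * (beta n)\<^sup>2) \<and>
     (\<forall>z \<in> dir_domain beta lam.
        (\<lambda>n. a n * exp (- (complex_of_real (lam n) * z))) sums f z) \<and>
     (\<forall>z. z \<notin> dir_domain beta lam \<longrightarrow> f z = 0)"

definition dir_space :: "(nat \<Rightarrow> real) \<Rightarrow> (nat \<Rightarrow> real) \<Rightarrow> (complex \<Rightarrow> complex) set" where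
  "dir_space beta lam = {f. \<exists>a. dir_coeffs_of beta lam f a}"

text \<open>
  Under the standing assumptions on \<open>lam\<close> and \<open>beta\<close> the coefficient sequence of a member of
  the space is unique, so \<open>THE\<close> is well-defined on \<open>dir_space\<close>.
\<close>

definition dir_coeff ::
    "(nat \<Rightarrow> real) \<Rightarrow> (nat \<Rightarrow> real) \<Rightarrow> (complex \<Rightarrow> complex) \<Rightarrow> nat \<Rightarrow> complex" where
  "dir_coeff beta lam f = (THE a. dir_coeffs_of beta lam f a)"

definition dir_inner ::
    "(nat \<Rightarrow> real) \<Rightarrow> (nat \<Rightarrow> real) \<Rightarrow> (complex \<Rightarrow> complex) \<Rightarrow> (complex \<Rightarrow> complex) \<Rightarrow> complex" where
  "dir_inner beta lam f g =
     (\<Sum>n. dir_coeff beta lam f n * cnj (dir_coeff beta lam g n) * complex_of_real ((beta n)\<^sup>2))"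

definition dir_norm :: "(nat \<Rightarrow> real) \<Rightarrow> (nat \<Rightarrow> real) \<Rightarrow> (complex \<Rightarrow> complex) \<Rightarrow> real" where
  "dir_norm beta lam f = sqrt (Re (dir_inner beta lam f f))"

definition comp_op :: "complex set \<Rightarrow> (complex \<Rightarrow> complex) \<Rightarrow> (complex \<Rightarrow> complex) \<Rightarrow> complex \<Rightarrow> complex"
  where "comp_op D \<phi> f = (\<lambda>z. if z \<in> D then f (\<phi> z) else 0)"

definition bounded_comp_op :: "(nat \<Rightarrow> real) \<Rightarrow> (nat \<Rightarrow> real) \<Rightarrow> (complex \<Rightarrow> complex) \<Rightarrow> bool" where
  "bounded_comp_op beta lam \<phi> \<longleftrightarrow>
     \<phi> holomorphic_on dir_domain beta lam \<and>
     \<phi> ` dir_domain beta lam \<subseteq> dir_domain beta lam \<and>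
     comp_op (dir_domain beta lam) \<phi> ` dir_space beta lam \<subseteq> dir_space beta lam \<and>
     (\<exists>K. \<forall>f \<in> dir_space beta lam.
        dir_norm beta lam (comp_op (dir_domain beta lam) \<phi> f) \<le> K * dir_norm beta lam f)"

definition initial_point :: "(nat \<Rightarrow> real) \<Rightarrow> real \<Rightarrow> nat \<Rightarrow> bool" where
  "initial_point lam a k \<longleftrightarrow> \<not> (\<exists>n<k. \<exists>s::nat. s \<ge> 1 \<and> a ^ s * lam n = lam k)"

global_interpretation cfun: vector_space "\<lambda>(c::complex) (f::complex \<Rightarrow> complex) z. c * f z"
  by unfold_locales (auto simp: fun_eq_iff algebra_simps)

definition orbit :: "('a \<Rightarrow> 'a) \<Rightarrow> 'a \<Rightarrow> 'a set" where
  "orbit T x = range (\<lambda>n. (T ^^ n) x)"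

text \<open>
  \<open>T\<close> is an operator on the linear subspace \<open>H\<close> of \<open>complex \<Rightarrow> complex\<close>, normed by \<open>nrm\<close>.
\<close>

definition cyclic_op ::
    "(complex \<Rightarrow> complex) set \<Rightarrow> ((complex \<Rightarrow> complex) \<Rightarrow> real) \<Rightarrow>
     ((complex \<Rightarrow> complex) \<Rightarrow> (complex \<Rightarrow> complex)) \<Rightarrow> bool" where
  "cyclic_op H nrm T \<longleftrightarrow>
     (\<exists>x \<in> H. \<forall>f \<in> H. \<forall>e > 0. \<exists>g \<in> cfun.span (orbit T x). nrm (f - g) < e)"

end

theory Submission imports Defs begin

text \<open>
  A cyclic operator cannot have a range contained in a closed subspace of codimension two. Indeed,
  let \<open>u\<close> and \<open>v\<close> be linearly independent bounded functionals vanishing on the range of \<open>T\<close>.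
  Every \<open>T\<^sup>n x\<close> with \<open>n \<ge> 1\<close> lies in that range, so \<open>(u, v)\<close> sends the whole span of the orbit
  of \<open>x\<close> into the line spanned by \<open>(u x, v x)\<close>. Some nonzero combination of \<open>u\<close> and \<open>v\<close>
  vanishes on this line, and by continuity the span is not dense
  (\<open>not_cyclic_op_if_two_functionals_kill_range\<close>).

  Here the two functionals are the coefficients at the two nonzero initial points. Substituting
  \<open>a z + b\<close> turns \<open>\<Sum>n. c n exp (- lam n z)\<close> into a series with frequencies \<open>a * lam n\<close>. A nonzero
  initial point \<open>lam k\<close> is not among those frequencies: \<open>a * lam n = lam k\<close> would force
  \<open>lam n < lam k\<close>, hence \<open>n < k\<close>, against the definition of an initial point. So the coefficient of the image at \<open>lam k\<close>
  is 0 (\<open>dir_coeff_comp_affine_initial_point\<close>).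

  This needs the fact that two absolutely convergent Dirichlet series with the same values on a
  vertical line, possibly with different sets of frequencies, have the same coefficient at every
  frequency (\<open>dirichlet_series_coeff_eq\<close>). Bohr's mean value formula gives it: the coefficient is
  the mean of the suitably rotated function along the line. Means over arithmetic progressions
  suffice here; they commute with the infinite sum without any integration. The same fact shows
  that the coefficients of a member of the space are unique, so they are linear functionals;
  they are bounded because the norm is a weighted \<open>l\<^sup>2\<close> norm.
\<close>

section \<open>Recovering coefficients by means along a vertical line\<close>

lemma mean_of_powers_tendsto:
  fixes w :: complex
  assumes "cmod w = 1"
  shows "(\<lambda>N. (\<Sum>k<N. w ^ k) / of_nat N) \<longlonglongrightarrow> (if w = 1 then 1 else 0)"
proof (cases "w = 1")
  case True
  have "eventually (\<lambda>N. (\<Sum>k<N. w ^ k) / of_nat N = 1) sequentially"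
    using eventually_gt_at_top[of 0] by eventually_elim (simp add: True)
  with True show ?thesis by (simp add: tendsto_eventually)
next
  case False
  have lim: "(\<lambda>N. 2 / cmod (w - 1) * (1 / real N)) \<longlonglongrightarrow> 0"
    by (intro tendsto_mult_right_zero lim_1_over_n)
  have "(\<lambda>N. (\<Sum>k<N. w ^ k) / of_nat N) \<longlonglongrightarrow> 0"
  proof (rule Lim_null_comparison[OF _ lim], intro always_eventually allI)
    fix N
    have "cmod (w ^ N - 1) \<le> 2"
      using norm_triangle_ineq4[of "w ^ N" 1] by (simp add: norm_power assms)
    then have "cmod (w ^ N - 1) / (cmod (w - 1) * real N) \<le> 2 / (cmod (w - 1) * real N)"
      by (intro divide_right_mono) auto
    then show "cmod ((\<Sum>k<N. w ^ k) / of_nat N) \<le> 2 / cmod (w - 1) * (1 / real N)"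
      using False by (simp add: geometric_sum norm_divide flip: norm_mult)
         (simp add: norm_mult)
  qed
  with False show ?thesis by simp
qed

text \<open>
  A mean over the points \<open>k * h\<close> cannot distinguish the frequency \<open>x\<close> from 0 if \<open>x * h\<close> is a
  multiple of \<open>2 * pi\<close>. Each nonzero \<open>x\<close> excludes only countably many steps \<open>h\<close>.
\<close>

lemma exists_step_without_aliasing:
  fixes S :: "real set"
  assumes "countable S"
  obtains h :: real where "\<And>x. x \<in> S \<Longrightarrow> cis (x * h) = 1 \<longleftrightarrow> x = 0"
proof -
  have "countable ((\<lambda>(x, n :: int). of_int (2 * n) * pi / x) ` (S \<times> UNIV))"
    using assms by (intro countable_image countable_SIGMA) auto
  then obtain h where h: "h \<notin> (\<lambda>(x, n :: int). of_int (2 * n) * pi / x) ` (S \<times> UNIV)"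
    using uncountable_UNIV_real by (metis UNIV_eq_I)
  show thesis
  proof (rule that)
    fix x assume x: "x \<in> S"
    show "cis (x * h) = 1 \<longleftrightarrow> x = 0"
    proof
      assume "cis (x * h) = 1"
      then obtain n :: int where n: "x * h = of_int (2 * n) * pi"
        by (auto simp: cis_conv_exp exp_eq_1)
      show "x = 0"
      proof (rule ccontr)
        assume "x \<noteq> 0"
        then have "h = of_int (2 * n) * pi / x" using n by (simp add: field_simps)
        with h x show False by (auto simp: image_iff)
      qed
    qed simp
  qed
qed

text \<open>
  The mean of each term tends to 0 unless its frequency is 0, and it is bounded by \<open>cmod (c n)\<close>;
  so Tannery's theorem allows taking the limit termwise.
\<close>

lemma mean_of_trigonometric_series_tendsto:
  fixes c :: "nat \<Rightarrow> complex" and x :: "nat \<Rightarrow> real" and h :: real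
  assumes c: "summable (\<lambda>n. cmod (c n))"
    and h: "\<And>n. cis (x n * h) = 1 \<longleftrightarrow> x n = 0"
  shows "(\<lambda>N. (\<Sum>k<N. \<Sum>n. c n * cis (x n * (real k * h))) / of_nat N)
           \<longlonglongrightarrow> (\<Sum>n. if x n = 0 then c n else 0)"
proof -
  define A where "A = (\<lambda>n N. c n * ((\<Sum>k<N. cis (x n * h) ^ k) / of_nat N))"
  have bound: "cmod (A n N) \<le> cmod (c n)" for n N
  proof -
    have "cmod (\<Sum>k<N. cis (x n * h) ^ k) \<le> real N"
      using norm_sum[of "\<lambda>k. cis (x n * h) ^ k" "{..<N}"] by (simp add: norm_power)
    then have "cmod ((\<Sum>k<N. cis (x n * h) ^ k) / of_nat N) \<le> 1"
      by (cases "N = 0") (simp_all add: norm_divide divide_le_eq_1)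
    then show ?thesis
      unfolding A_def norm_mult by (simp add: mult_left_le)
  qed
  have "(\<lambda>N. A n N) \<longlonglongrightarrow> (if x n = 0 then c n else 0)" for n
    using tendsto_mult_left[OF mean_of_powers_tendsto[of "cis (x n * h)"], of "c n"] h[of n]
    unfolding A_def by (simp split: if_splits)
  then have "(\<lambda>N. \<Sum>n. A n N) \<longlonglongrightarrow> (\<Sum>n. if x n = 0 then c n else 0)"
    using tannerys_theorem[of A "\<lambda>n. if x n = 0 then c n else 0" sequentially "\<lambda>n. cmod (c n)"]
      bound c by (simp add: case_prod_unfold)
  moreover have "(\<Sum>n. A n N) = (\<Sum>k<N. \<Sum>n. c n * cis (x n * (real k * h))) / of_nat N" for N
  proof -
    have s: "summable (\<lambda>n. c n * cis (x n * (real k * h)))" for k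
      by (rule summable_norm_cancel) (simp add: norm_mult c)
    have "cis (x n * h) ^ k = cis (x n * (real k * h))" for n k
      by (simp add: Complex.DeMoivre mult.left_commute)
    then have "A n N = (\<Sum>k<N. c n * cis (x n * (real k * h))) / of_nat N" for n
      unfolding A_def by (simp add: sum_distrib_left)
    then have "(\<Sum>n. A n N) = (\<Sum>n. (\<Sum>k<N. c n * cis (x n * (real k * h))) / of_nat N)"
      by simp
    also have "\<dots> = (\<Sum>n. \<Sum>k<N. c n * cis (x n * (real k * h))) / of_nat N"
      by (intro suminf_divide summable_sum s)
    also have "\<dots> = (\<Sum>k<N. \<Sum>n. c n * cis (x n * (real k * h))) / of_nat N"
      by (simp add: suminf_sum s)
    finally show ?thesis .
  qed
  ultimately show ?thesis by simp
qed

text \<open>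
  Multiplying by \<open>cis (- \<theta> * t)\<close> moves the frequency \<open>\<theta>\<close> to 0, where the mean picks it out. The
  step is chosen for both frequency sequences at once, so that both sides are means of the same
  values. The sums over \<open>n\<close> allow \<open>\<theta>\<close> to occur several times or not at all.
\<close>

lemma trigonometric_series_coeff_eq:
  fixes c d :: "nat \<Rightarrow> complex" and \<mu> \<nu> :: "nat \<Rightarrow> real" and \<theta> :: real
  assumes c: "summable (\<lambda>n. cmod (c n))" and d: "summable (\<lambda>n. cmod (d n))"
    and eq: "\<And>t. (\<Sum>n. c n * cis (\<mu> n * t)) = (\<Sum>n. d n * cis (\<nu> n * t))"
  shows "(\<Sum>n. if \<mu> n = \<theta> then c n else 0) = (\<Sum>n. if \<nu> n = \<theta> then d n else 0)"
proof -
  obtain h where h: "\<And>x. x \<in> range (\<lambda>n. \<mu> n - \<theta>) \<union> range (\<lambda>n. \<nu> n - \<theta>)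
      \<Longrightarrow> cis (x * h) = 1 \<longleftrightarrow> x = 0"
    using exists_step_without_aliasing[of "range (\<lambda>n. \<mu> n - \<theta>) \<union> range (\<lambda>n. \<nu> n - \<theta>)"] by auto
  have shift: "(\<Sum>n. e n * cis ((\<kappa> n - \<theta>) * t)) = cis (- \<theta> * t) * (\<Sum>n. e n * cis (\<kappa> n * t))"
    if e: "summable (\<lambda>n. cmod (e n))" for e :: "nat \<Rightarrow> complex" and \<kappa> :: "nat \<Rightarrow> real" and t
  proof -
    have "summable (\<lambda>n. e n * cis (\<kappa> n * t))"
      by (rule summable_norm_cancel) (simp add: norm_mult e)
    from suminf_mult[OF this, of "cis (- \<theta> * t)"] show ?thesis
      by (simp add: cis_mult algebra_simps)
  qed
  have "(\<Sum>n. c n * cis ((\<mu> n - \<theta>) * t)) = (\<Sum>n. d n * cis ((\<nu> n - \<theta>) * t))" for t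
    unfolding shift[OF c] shift[OF d] eq ..
  moreover have "(\<lambda>N. (\<Sum>k<N. \<Sum>n. c n * cis ((\<mu> n - \<theta>) * (real k * h))) / of_nat N)
      \<longlonglongrightarrow> (\<Sum>n. if \<mu> n - \<theta> = 0 then c n else 0)"
    by (rule mean_of_trigonometric_series_tendsto[OF c]) (rule h, auto)
  moreover have "(\<lambda>N. (\<Sum>k<N. \<Sum>n. d n * cis ((\<nu> n - \<theta>) * (real k * h))) / of_nat N)
      \<longlonglongrightarrow> (\<Sum>n. if \<nu> n - \<theta> = 0 then d n else 0)"
    by (rule mean_of_trigonometric_series_tendsto[OF d]) (rule h, auto)
  ultimately show ?thesis
    using LIMSEQ_unique by fastforce
qed

lemma dirichlet_series_coeff_eq:
  fixes c d :: "nat \<Rightarrow> complex" and \<mu> \<nu> :: "nat \<Rightarrow> real" and \<sigma> \<theta> :: real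
  assumes c: "summable (\<lambda>n. cmod (c n * exp (- (of_real (\<mu> n) * of_real \<sigma>))))"
    and d: "summable (\<lambda>n. cmod (d n * exp (- (of_real (\<nu> n) * of_real \<sigma>))))"
    and cF: "\<And>z. Re z = \<sigma> \<Longrightarrow> (\<lambda>n. c n * exp (- (of_real (\<mu> n) * z))) sums F z"
    and dF: "\<And>z. Re z = \<sigma> \<Longrightarrow> (\<lambda>n. d n * exp (- (of_real (\<nu> n) * z))) sums F z"
  shows "(\<Sum>n. if \<mu> n = \<theta> then c n * exp (- (of_real (\<mu> n) * of_real \<sigma>)) else 0)
       = (\<Sum>n. if \<nu> n = \<theta> then d n * exp (- (of_real (\<nu> n) * of_real \<sigma>)) else 0)"
proof (rule trigonometric_series_coeff_eq[OF c d])
  fix t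
  have "exp (- (of_real \<kappa> * Complex \<sigma> (- t))) = exp (- (of_real \<kappa> * of_real \<sigma>)) * cis (\<kappa> * t)" for \<kappa>
    unfolding Complex_eq cis_conv_exp exp_add[symmetric] by (simp add: algebra_simps)
  then show "(\<Sum>n. c n * exp (- (of_real (\<mu> n) * of_real \<sigma>)) * cis (\<mu> n * t))
           = (\<Sum>n. d n * exp (- (of_real (\<nu> n) * of_real \<sigma>)) * cis (\<nu> n * t))"
    using cF[of "Complex \<sigma> (- t)"] dF[of "Complex \<sigma> (- t)"]
    by (simp add: sums_iff mult.assoc)
qed

section \<open>Coefficients in the space of Dirichlet series\<close>

text \<open>
  Far enough to the right, the exponential outweighs both the growth of the coefficients and the
  density of the frequencies. With \<open>ln (n + 1) \<le> C * lam n\<close> and \<open>exp (B * lam n) \<le> beta n\<close> for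
  large \<open>n\<close>, the boundedness of \<open>c n * beta n\<close> makes the \<open>n\<close>-th term at most
  \<open>exp (- (Re z + B) * lam n)\<close>, which is at most \<open>1 / (n + 1)\<^sup>2\<close> as soon as \<open>Re z + B \<ge> 2 * C\<close>.
  The abscissa depends on \<open>lam\<close> and \<open>beta\<close> only, so one vertical line serves all members of the
  space.
\<close>

lemma dirichlet_series_abs_convergent:
  fixes lam beta :: "nat \<Rightarrow> real"
  assumes nonneg: "\<And>n. lam n \<ge> 0"
    and lim: "filterlim lam at_top sequentially"
    and L: "dir_L lam < \<infinity>"
    and pos: "\<And>n. beta n > 0"
    and bs: "dir_beta_star beta lam \<noteq> -\<infinity>"
  obtains s where "\<And>c z. summable (\<lambda>n. (cmod (c n))\<^sup>2 * (beta n)\<^sup>2) \<Longrightarrow> Re z \<ge> s \<Longrightarrow>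
      summable (\<lambda>n. cmod (c n * exp (- (of_real (lam n) * z))))"
proof -
  from L obtain C where C: "dir_L lam < ereal C"
    using less_PInf_Ex_of_nat by fastforce
  from bs have "- \<infinity> < dir_beta_star beta lam" by auto
  then obtain B where B: "ereal B < dir_beta_star beta lam"
    using ereal_dense2 by blast
  have ev: "eventually (\<lambda>n. ln (real (Suc n)) \<le> C * lam n \<and> exp (B * lam n) \<le> beta n) sequentially"
    using Limsup_lessD[OF C[unfolded dir_L_def]]
      less_LiminfD[OF B[unfolded dir_beta_star_def]]
      filterlim_at_top_dense[THEN iffD1, OF lim, rule_format, of 0]
  proof eventually_elim
    case (elim n)
    have "B * lam n \<le> ln (beta n)" using elim by (simp add: field_simps)
    then show ?case using elim pos[of n]
      by (auto simp: field_simps ln_ge_iff)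
  qed
  show thesis
  proof (rule that[of "2 * C - B"])
    fix c :: "nat \<Rightarrow> complex" and z :: complex
    assume c: "summable (\<lambda>n. (cmod (c n))\<^sup>2 * (beta n)\<^sup>2)" and z: "Re z \<ge> 2 * C - B"
    have small: "eventually (\<lambda>n. (cmod (c n))\<^sup>2 * (beta n)\<^sup>2 < 1) sequentially"
      using order_tendstoD(2)[OF summable_LIMSEQ_zero[OF c], of 1] by simp
    have "eventually (\<lambda>n. norm (cmod (c n * exp (- (of_real (lam n) * z))))
            \<le> inverse ((real (Suc n))\<^sup>2)) sequentially"
      using ev small
    proof eventually_elim
      case (elim n)
      have "(cmod (c n) * beta n)\<^sup>2 \<le> 1\<^sup>2" using elim by (simp add: power_mult_distrib)
      then have cb: "cmod (c n) * beta n \<le> 1" by (rule power2_le_imp_le) simp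
      have "cmod (c n) * exp (B * lam n) \<le> 1"
        using elim cb mult_left_mono[of "exp (B * lam n)" "beta n" "cmod (c n)"] by auto
      then have "cmod (c n) \<le> exp (- (B * lam n))"
        by (simp add: exp_minus field_simps)
      then have "cmod (c n) * exp (- (lam n * Re z)) \<le> exp (- (B * lam n)) * exp (- (lam n * Re z))"
        by (rule mult_right_mono) simp
      also have "\<dots> = exp (- (lam n * (Re z + B)))"
        by (simp add: exp_add[symmetric] algebra_simps)
      also have "\<dots> \<le> exp (- (2 * ln (real (Suc n))))"
      proof -
        have "lam n * (2 * C) \<le> lam n * (Re z + B)"
          using z nonneg[of n] by (intro mult_left_mono) auto
        then show ?thesis using elim by (simp add: algebra_simps)
      qed
      also have "\<dots> = inverse ((real (Suc n))\<^sup>2)"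
        by (simp only: exp_minus exp_double exp_ln of_nat_0_less_iff zero_less_Suc)
      finally show ?case by (simp add: norm_mult norm_exp_eq_Re)
    qed
    moreover have "summable (\<lambda>n. inverse ((real (Suc n))\<^sup>2))"
      using inverse_power_summable[of 2, where 'a = real] by (subst summable_Suc_iff) simp
    ultimately show "summable (\<lambda>n. cmod (c n * exp (- (of_real (lam n) * z))))"
      by (rule summable_comparison_test_ev)
  qed
qed

lemma suminf_inj_single:
  fixes g :: "nat \<Rightarrow> complex"
  assumes "inj lam"
  shows "(\<Sum>n. if lam n = lam k then g n else 0) = g k"
proof -
  have "(\<lambda>n. if lam n = lam k then g n else 0) = (\<lambda>n. if n = k then g n else 0)"
    using assms by (auto simp: inj_eq)
  then show ?thesis using sums_single[of k g] by (simp add: sums_iff)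
qed

locale dirichlet_space =
  fixes lam beta :: "nat \<Rightarrow> real"
  assumes mono: "strict_mono lam"
    and nonneg: "\<And>n. lam n \<ge> 0"
    and lim: "filterlim lam at_top sequentially"
    and L: "dir_L lam < \<infinity>"
    and pos: "\<And>n. beta n > 0"
    and bs: "dir_beta_star beta lam \<noteq> -\<infinity>"
begin

lemma inj_lam: "inj lam"
  using mono by (rule strict_mono_imp_inj_on)

lemma far_right_line:
  obtains s where "\<And>z. Re z \<ge> s \<Longrightarrow> z \<in> dir_domain beta lam"
    and "\<And>c z. summable (\<lambda>n. (cmod (c n))\<^sup>2 * (beta n)\<^sup>2) \<Longrightarrow> Re z \<ge> s \<Longrightarrow>
      summable (\<lambda>n. cmod (c n * exp (- (of_real (lam n) * z))))"
proof -
  obtain s where s: "\<And>c z. summable (\<lambda>n. (cmod (c n))\<^sup>2 * (beta n)\<^sup>2) \<Longrightarrow> Re z \<ge> s \<Longrightarrow>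
      summable (\<lambda>n. cmod (c n * exp (- (of_real (lam n) * z))))"
    using dirichlet_series_abs_convergent[OF nonneg lim L pos bs] by blast
  obtain r where r: "\<And>z. Re z \<ge> r \<Longrightarrow> z \<in> dir_domain beta lam"
    
    by (rule that[of "real_of_ereal (dir_L lam) / 2 - real_of_ereal (dir_beta_star beta lam) + 1"])
       (auto simp: dir_domain_def half_plane_def)
  show thesis by (rule that[of "max r s"]) (auto intro: r s)
qed

lemma dir_coeffs_unique:
  assumes "dir_coeffs_of beta lam f c" and "dir_coeffs_of beta lam f d"
  shows "c = d"
proof
  fix k
  obtain s where dom: "\<And>z. Re z \<ge> s \<Longrightarrow> z \<in> dir_domain beta lam"
    and abs: "\<And>c z. summable (\<lambda>n. (cmod (c n))\<^sup>2 * (beta n)\<^sup>2) \<Longrightarrow> Re z \<ge> s \<Longrightarrow>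
      summable (\<lambda>n. cmod (c n * exp (- (of_real (lam n) * z))))"
    using far_right_line by blast
  have "(\<Sum>n. if lam n = lam k then c n * exp (- (of_real (lam n) * of_real s)) else 0)
      = (\<Sum>n. if lam n = lam k then d n * exp (- (of_real (lam n) * of_real s)) else 0)"
    using assms unfolding dir_coeffs_of_def
    by (intro dirichlet_series_coeff_eq[where F = f] abs) (auto intro: dom)
  then show "c k = d k" by (simp add: suminf_inj_single[OF inj_lam])
qed

lemma dir_coeff_eqI: "dir_coeffs_of beta lam f c \<Longrightarrow> dir_coeff beta lam f = c"
  unfolding dir_coeff_def by (rule the_equality) (auto dest: dir_coeffs_unique)

lemma dir_coeffs_of_dir_coeff:
  "f \<in> dir_space beta lam \<Longrightarrow> dir_coeffs_of beta lam f (dir_coeff beta lam f)"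
  using dir_coeff_eqI unfolding dir_space_def by fastforce

lemma dir_coeffs_of_zero: "dir_coeffs_of beta lam 0 (\<lambda>_. 0)"
  by (simp add: dir_coeffs_of_def)

lemma dir_coeffs_of_scale:
  assumes "dir_coeffs_of beta lam f c"
  shows "dir_coeffs_of beta lam (\<lambda>z. r * f z) (\<lambda>n. r * c n)"
  using assms unfolding dir_coeffs_of_def
  by (auto simp: norm_mult power_mult_distrib mult.assoc intro: summable_mult sums_mult)

lemma dir_coeffs_of_add:
  assumes f: "dir_coeffs_of beta lam f c" and g: "dir_coeffs_of beta lam g d"
  shows "dir_coeffs_of beta lam (f + g) (\<lambda>n. c n + d n)"
proof -
  have "summable (\<lambda>n. 2 * ((cmod (c n))\<^sup>2 * (beta n)\<^sup>2) + 2 * ((cmod (d n))\<^sup>2 * (beta n)\<^sup>2))"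
    using f g by (intro summable_add summable_mult) (auto simp: dir_coeffs_of_def)
  moreover have "(cmod (c n + d n))\<^sup>2 * (beta n)\<^sup>2
      \<le> 2 * ((cmod (c n))\<^sup>2 * (beta n)\<^sup>2) + 2 * ((cmod (d n))\<^sup>2 * (beta n)\<^sup>2)" for n
  proof -
    have "(cmod (c n + d n))\<^sup>2 \<le> (cmod (c n) + cmod (d n))\<^sup>2"
      by (intro power_mono norm_triangle_ineq) simp
    also have "\<dots> \<le> 2 * (cmod (c n))\<^sup>2 + 2 * (cmod (d n))\<^sup>2"
      using zero_le_power2[of "cmod (c n) - cmod (d n)"] by (simp add: power2_eq_square algebra_simps)
    finally show ?thesis
      using mult_right_mono[of _ _ "(beta n)\<^sup>2"] by (fastforce simp: algebra_simps)
  qed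
  ultimately have "summable (\<lambda>n. (cmod (c n + d n))\<^sup>2 * (beta n)\<^sup>2)"
    by - (rule summable_comparison_test'[where N = 0], assumption, simp)
  then show ?thesis
    using f g unfolding dir_coeffs_of_def by (auto simp: distrib_right intro: sums_add)
qed

lemma subspace_dir_space: "cfun.subspace (dir_space beta lam)"
  unfolding cfun.subspace_def dir_space_def
  using dir_coeffs_of_zero dir_coeffs_of_add dir_coeffs_of_scale by blast

lemma dir_coeff_add:
  assumes "f \<in> dir_space beta lam" "g \<in> dir_space beta lam"
  shows "dir_coeff beta lam (f + g) n = dir_coeff beta lam f n + dir_coeff beta lam g n"
  using dir_coeff_eqI[OF dir_coeffs_of_add[OF assms[THEN dir_coeffs_of_dir_coeff]]] by simp

lemma dir_coeff_scale:
  assumes "f \<in> dir_space beta lam"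
  shows "dir_coeff beta lam (\<lambda>z. r * f z) n = r * dir_coeff beta lam f n"
  using dir_coeff_eqI[OF dir_coeffs_of_scale[OF assms[THEN dir_coeffs_of_dir_coeff]]] by simp

lemma cmod_dir_coeff_le:
  assumes "f \<in> dir_space beta lam"
  shows "cmod (dir_coeff beta lam f n) \<le> inverse (beta n) * dir_norm beta lam f"
proof -
  define c where "c = dir_coeff beta lam f"
  have s: "summable (\<lambda>n. (cmod (c n))\<^sup>2 * (beta n)\<^sup>2)"
    using dir_coeffs_of_dir_coeff[OF assms] by (simp add: c_def dir_coeffs_of_def)
  have "c n * cnj (c n) * of_real ((beta n)\<^sup>2) = of_real ((cmod (c n))\<^sup>2 * (beta n)\<^sup>2)" for n
    by (simp add: complex_norm_square[symmetric])
  then have "dir_inner beta lam f f = of_real (\<Sum>n. (cmod (c n))\<^sup>2 * (beta n)\<^sup>2)"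
    by (simp only: dir_inner_def c_def[symmetric] suminf_of_real[OF s])
  then have norm: "dir_norm beta lam f = sqrt (\<Sum>n. (cmod (c n))\<^sup>2 * (beta n)\<^sup>2)"
    by (simp add: dir_norm_def)
  have "(cmod (c n) * beta n)\<^sup>2 \<le> (\<Sum>n. (cmod (c n))\<^sup>2 * (beta n)\<^sup>2)"
    using sum_le_suminf[OF s, of "{n}"] by (simp add: power_mult_distrib)
  then have "cmod (c n) * beta n \<le> dir_norm beta lam f"
    unfolding norm by (rule real_le_rsqrt)
  then show ?thesis using pos[of n] by (simp add: c_def field_simps)
qed

lemma dir_norm_nonneg:
  assumes "f \<in> dir_space beta lam"
  shows "dir_norm beta lam f \<ge> 0"
proof -
  have "0 \<le> inverse (beta 0) * dir_norm beta lam f"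
    using cmod_dir_coeff_le[OF assms, of 0] norm_ge_zero by (rule order_trans[rotated])
  then show ?thesis using pos[of 0] by (simp add: zero_le_mult_iff)
qed

lemma monomial_in_dir_space:
  obtains e where "e \<in> dir_space beta lam"
    and "\<And>n. dir_coeff beta lam e n = (if n = k then 1 else 0)"
proof -
  define e where "e = (\<lambda>z. if z \<in> dir_domain beta lam then exp (- (of_real (lam k) * z)) else 0)"
  have "(\<lambda>n. (if n = k then 1 else 0) * exp (- (of_real (lam n) * z))) sums exp (- (of_real (lam k) * z))" for z :: complex
    using sums_single[of k "\<lambda>n. exp (- (of_real (lam n) * z))"] by (simp add: if_distrib[of "\<lambda>x. x * _"] cong: if_cong)
  moreover have "(\<lambda>n. (cmod (if n = k then 1 else 0))\<^sup>2 * (beta n)\<^sup>2) = (\<lambda>n. if n = k then (beta n)\<^sup>2 else 0)"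
    by auto
  ultimately have "dir_coeffs_of beta lam e (\<lambda>n. if n = k then 1 else 0)"
    unfolding dir_coeffs_of_def e_def by (auto intro: sums_summable[OF sums_single])
  then show thesis
    using that[of e] by (auto simp: dir_space_def dir_coeff_eqI)
qed

text \<open>
  The image under the substitution has two expansions: its own, with frequencies \<open>lam n\<close>, and the
  substituted one, with frequencies \<open>a * lam n\<close>. The latter does not contain \<open>lam k\<close>, and the
  coefficients of the two agree.
\<close>

lemma dir_coeff_comp_affine_initial_point:
  fixes a :: real and b :: complex
  assumes a: "a > 1"
    and self: "(\<lambda>z. of_real a * z + b) ` dir_domain beta lam \<subseteq> dir_domain beta lam"
    and f: "f \<in> dir_space beta lam"
    and Tf: "comp_op (dir_domain beta lam) (\<lambda>z. of_real a * z + b) f \<in> dir_space beta lam"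
    and k: "initial_point lam a k" "lam k \<noteq> 0"
  shows "dir_coeff beta lam (comp_op (dir_domain beta lam) (\<lambda>z. of_real a * z + b) f) k = 0"
proof -
  define g where "g = comp_op (dir_domain beta lam) (\<lambda>z. of_real a * z + b) f"
  define c where "c = dir_coeff beta lam f"
  define d where "d = dir_coeff beta lam g"
  have c: "dir_coeffs_of beta lam f c" and d: "dir_coeffs_of beta lam g d"
    using f Tf dir_coeffs_of_dir_coeff by (auto simp: c_def d_def g_def)
  obtain s where dom: "\<And>z. Re z \<ge> s \<Longrightarrow> z \<in> dir_domain beta lam"
    and abs: "\<And>c z. summable (\<lambda>n. (cmod (c n))\<^sup>2 * (beta n)\<^sup>2) \<Longrightarrow> Re z \<ge> s \<Longrightarrow>
      summable (\<lambda>n. cmod (c n * exp (- (of_real (lam n) * z))))"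
    using far_right_line by blast
  \<comment> \<open>On the line \<open>Re z = \<sigma>\<close> both \<open>z\<close> and \<open>a * z + b\<close> have real part at least \<open>s\<close>, so both
      expansions converge absolutely there.\<close>
  define \<sigma> where "\<sigma> = max s ((s - Re b) / a)"
  have \<sigma>: "\<sigma> \<ge> s" "a * \<sigma> + Re b \<ge> s"
    using a by (auto simp: \<sigma>_def field_simps max_def)
  have split: "c n * exp (- (of_real (lam n) * (of_real a * z + b)))
      = c n * exp (- (of_real (lam n) * b)) * exp (- (of_real (a * lam n) * z))" for n z
    by (simp add: exp_add[symmetric] mult.assoc algebra_simps)
  have "(\<Sum>n. if lam n = lam k then d n * exp (- (of_real (lam n) * of_real \<sigma>)) else 0)
      = (\<Sum>n. if a * lam n = lam k then c n * exp (- (of_real (lam n) * b))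
              * exp (- (of_real (a * lam n) * of_real \<sigma>)) else 0)"
  proof (rule dirichlet_series_coeff_eq[where F = g])
    show "summable (\<lambda>n. cmod (d n * exp (- (of_real (lam n) * of_real \<sigma>))))"
      using d \<sigma> by (intro abs) (auto simp: dir_coeffs_of_def)
    show "summable (\<lambda>n. cmod (c n * exp (- (of_real (lam n) * b))
              * exp (- (of_real (a * lam n) * of_real \<sigma>))))"
      unfolding split[symmetric] using c \<sigma> by (intro abs) (auto simp: dir_coeffs_of_def)
  next
    fix z assume z: "Re z = \<sigma>"
    then have zD: "z \<in> dir_domain beta lam" using \<sigma> by (auto intro: dom)
    then show "(\<lambda>n. d n * exp (- (of_real (lam n) * z))) sums g z"
      using d by (auto simp: dir_coeffs_of_def)
    have "of_real a * z + b \<in> dir_domain beta lam" using zD self by auto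
    then have "(\<lambda>n. c n * exp (- (of_real (lam n) * (of_real a * z + b)))) sums f (of_real a * z + b)"
      using c unfolding dir_coeffs_of_def by blast
    then show "(\<lambda>n. c n * exp (- (of_real (lam n) * b)) * exp (- (of_real (a * lam n) * z))) sums g z"
      unfolding split using zD by (simp add: g_def comp_op_def)
  qed
  moreover have "a * lam n \<noteq> lam k" for n
  proof
    assume eq: "a * lam n = lam k"
    then have "lam n > 0" using k nonneg[of n] by (cases "lam n = 0") auto
    then have "lam n < lam k" using a eq by (metis mult.left_neutral mult_less_cancel_right_pos)
    then have "n < k" using mono by (simp add: strict_mono_less)
    with k eq show False unfolding initial_point_def by (metis le_refl power_one_right)
  qed
  ultimately show ?thesis
    by (simp add: suminf_inj_single[OF inj_lam] d_def g_def)
qed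

end

section \<open>A cyclic operator has range of codimension at most one\<close>

text \<open>
  Along the orbit of \<open>x\<close>, the pair \<open>(u, v)\<close> is nonzero at most at \<open>x\<close> itself, so one linear equation
  chosen to hold at \<open>x\<close> holds on the whole span. It is a closed condition, but by independence it
  fails somewhere on \<open>H\<close>.
\<close>

lemma not_cyclic_op_if_two_functionals_kill_range:
  fixes u v :: "(complex \<Rightarrow> complex) \<Rightarrow> complex"
  assumes H: "cfun.subspace H"
    and T: "T ` H \<subseteq> H"
    and u_add: "\<And>f g. f \<in> H \<Longrightarrow> g \<in> H \<Longrightarrow> u (f + g) = u f + u g"
    and v_add: "\<And>f g. f \<in> H \<Longrightarrow> g \<in> H \<Longrightarrow> v (f + g) = v f + v g"
    and u_scale: "\<And>r f. f \<in> H \<Longrightarrow> u (\<lambda>z. r * f z) = r * u f"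
    and v_scale: "\<And>r f. f \<in> H \<Longrightarrow> v (\<lambda>z. r * f z) = r * v f"
    and nrm_nonneg: "\<And>f. f \<in> H \<Longrightarrow> nrm f \<ge> 0"
    and K: "K \<ge> 0" and M: "M \<ge> 0"
    and u_bound: "\<And>f. f \<in> H \<Longrightarrow> cmod (u f) \<le> K * nrm f"
    and v_bound: "\<And>f. f \<in> H \<Longrightarrow> cmod (v f) \<le> M * nrm f"
    and u_range: "\<And>f. f \<in> H \<Longrightarrow> u (T f) = 0"
    and v_range: "\<And>f. f \<in> H \<Longrightarrow> v (T f) = 0"
    and indep: "\<And>p q. (\<And>f. f \<in> H \<Longrightarrow> p * u f + q * v f = 0) \<Longrightarrow> p = 0 \<and> q = 0"
  shows "\<not> cyclic_op H nrm T"
proof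
  assume "cyclic_op H nrm T"
  then obtain x where x: "x \<in> H"
    and dense: "\<And>f e. f \<in> H \<Longrightarrow> e > 0 \<Longrightarrow> \<exists>g \<in> cfun.span (orbit T x). nrm (f - g) < e"
    unfolding cyclic_op_def by blast
  obtain p q where pq: "p \<noteq> 0 \<or> q \<noteq> 0" and px: "p * u x + q * v x = 0"
  proof (cases "u x = 0")
    case True
    then show ?thesis using that[of 1 0] by simp
  next
    case False
    then show ?thesis using that[of "v x" "- u x"] by simp
  qed
  define l where "l f = p * u f + q * v f" for f
  have l_add: "l (f + g) = l f + l g" if "f \<in> H" "g \<in> H" for f g
    using that by (simp add: l_def u_add v_add algebra_simps)
  have l_scale: "l (\<lambda>z. r * f z) = r * l f" if "f \<in> H" for r f
    using that by (simp add: l_def u_scale v_scale algebra_simps)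
  have iter: "(T ^^ n) x \<in> H" for n
    by (induction n) (use x T in auto)
  have l_iter: "l ((T ^^ n) x) = 0" for n
    by (cases n) (use iter in \<open>auto simp: l_def px u_range v_range\<close>)
  have "orbit T x \<subseteq> {g \<in> H. l g = 0}"
    using iter l_iter by (auto simp: orbit_def)
  moreover have "cfun.subspace {g \<in> H. l g = 0}"
    using H l_add l_scale l_scale[OF x, of 0] unfolding cfun.subspace_def
    by (auto simp: zero_fun_def)
  ultimately have span: "cfun.span (orbit T x) \<subseteq> {g \<in> H. l g = 0}"
    by (rule cfun.span_minimal)
  \<comment> \<open>\<open>E\<close> bounds the norm of \<open>l\<close>; the summand 1 keeps it positive.\<close>
  define E where "E = cmod p * K + cmod q * M + 1"
  have E: "E > 0" using K M by (auto simp: E_def intro!: add_nonneg_pos)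
  have "l f = 0" if f: "f \<in> H" for f
  proof (rule ccontr)
    assume nz: "l f \<noteq> 0"
    then have "cmod (l f) / E > 0" using E by simp
    then obtain g where g: "g \<in> cfun.span (orbit T x)" and near: "nrm (f - g) < cmod (l f) / E"
      using dense[OF f] by blast
    have gH: "g \<in> H" and lg: "l g = 0" using span g by auto
    have fg: "f - g \<in> H" using H f gH by (rule cfun.subspace_diff)
    have "l f = l (f - g)" using l_add[OF fg gH] lg by simp
    then have "cmod (l f) \<le> cmod p * cmod (u (f - g)) + cmod q * cmod (v (f - g))"
      by (simp add: l_def norm_mult[symmetric] norm_triangle_ineq)
    also have "\<dots> \<le> cmod p * (K * nrm (f - g)) + cmod q * (M * nrm (f - g))"
      using u_bound[OF fg] v_bound[OF fg] by (intro add_mono mult_left_mono) auto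
    also have "\<dots> = E * nrm (f - g) - nrm (f - g)" by (simp add: E_def algebra_simps)
    also have "\<dots> \<le> E * nrm (f - g)" using nrm_nonneg[OF fg] by simp
    also have "\<dots> < cmod (l f)" using near E by (simp add: field_simps)
    finally show False by simp
  qed
  then have "p = 0 \<and> q = 0" by (intro indep) (simp add: l_def)
  with pq show False by simp
qed

theorem proposition5p7:
  fixes lam beta :: "nat \<Rightarrow> real" and a :: real and b :: complex
  assumes "strict_mono lam"
    and "\<And>n. lam n \<ge> 0"
    and "filterlim lam at_top sequentially"
    and "dir_L lam < \<infinity>"
    and "\<And>n. beta n > 0"
    and "dir_beta_star beta lam \<noteq> \<infinity>"
    and "dir_beta_star beta lam \<noteq> -\<infinity>"
    and "a > 1"
    and "bounded_comp_op beta lam (\<lambda>z. complex_of_real a * z + b)"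
    and "\<exists>j k. j \<noteq> k \<and> lam j \<noteq> 0 \<and> lam k \<noteq> 0 \<and> initial_point lam a j \<and> initial_point lam a k"
  shows "\<not> cyclic_op (dir_space beta lam) (dir_norm beta lam)
           (comp_op (dir_domain beta lam) (\<lambda>z. complex_of_real a * z + b))"
proof -
  interpret dirichlet_space lam beta
    using assms by unfold_locales
  obtain j k where jk: "j \<noteq> k" "lam j \<noteq> 0" "lam k \<noteq> 0" "initial_point lam a j" "initial_point lam a k"
    using assms(10) by blast
  let ?H = "dir_space beta lam"
  let ?T = "comp_op (dir_domain beta lam) (\<lambda>z. complex_of_real a * z + b)"
  have self: "(\<lambda>z. of_real a * z + b) ` dir_domain beta lam \<subseteq> dir_domain beta lam"
    and T: "?T ` ?H \<subseteq> ?H"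
    using assms(9) unfolding bounded_comp_op_def by blast+
  have kill: "dir_coeff beta lam (?T f) i = 0"
    if "f \<in> ?H" "initial_point lam a i" "lam i \<noteq> 0" for f i
    using dir_coeff_comp_affine_initial_point[OF \<open>a > 1\<close> self] that T by blast
  show ?thesis
  proof (rule not_cyclic_op_if_two_functionals_kill_range[where
        u = "\<lambda>f. dir_coeff beta lam f j" and v = "\<lambda>f. dir_coeff beta lam f k"
        and K = "inverse (beta j)" and M = "inverse (beta k)"])
    fix p q
    assume zero: "\<And>f. f \<in> ?H \<Longrightarrow> p * dir_coeff beta lam f j + q * dir_coeff beta lam f k = 0"
    obtain e where e: "e \<in> ?H" "\<And>n. dir_coeff beta lam e n = (if n = j then 1 else 0)"
      using monomial_in_dir_space by blast
    obtain e' where e': "e' \<in> ?H" "\<And>n. dir_coeff beta lam e' n = (if n = k then 1 else 0)"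
      using monomial_in_dir_space by blast
    show "p = 0 \<and> q = 0" using zero[OF e(1)] zero[OF e'(1)] jk(1) by (simp add: e e')
  qed (use jk T kill subspace_dir_space dir_coeff_add dir_coeff_scale cmod_dir_coeff_le dir_norm_nonneg
      less_imp_le[OF pos] in \<open>auto\<close>)
qed

end
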